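(* Let $T$ be the football tree and let $\operatorname{Aut}(T)$ be its group of orientation-preserving automorphisms. Then $\operatorname{Aut}(T)$ is isomorphic to the free product $\mathbb{Z}_2\star\mathbb{Z}_3\star\mathbb{Z}_5$ of cyclic groups of orders $2$, $3$ and $5$.
   Context: A ribbon graph is a graph with a cyclic order on the edge-ends at each vertex. A football graph is a connected ribbon graph (possibly infinite) with black and white vertices such that: (1) each black vertex has valence five, and all five edges connect it to white vertices; (2) each white vertex has valence six, and its six edges, in cyclic order, alternately connect it to black and white vertices. Up to isomorphism there is precisely one football graph that is connected and simply connected (i.e. a tree). It is called the football tree $T$, and it is the universal cover of every football graph. Orientation-preserving automorphisms of $T$ are the automorphisms of the underlying graph that preserve the vertex colours and the cyclic orders at all vertices. Inversions of edges are allowed. *)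

theory Defs
  imports
    "Graph_Theory.Digraph_Component"
    "Graph_Theory.Bidirected_Digraph"
    "HOL-Combinatorics.Orbits"
    "HOL-Algebra.Bij"
    "HOL-Algebra.Elementary_Groups"
begin

section \<open>Ribbon graphs\<close>

text \<open>
  A graph (loops and multiple edges allowed, possibly infinite) is a bidirected digraph: an edge
  is a pair of arcs exchanged by \<open>arev\<close>, and an arc \<open>a\<close> stands for the edge-end at the
  vertex \<open>tail G a\<close>, so that \<open>out_arcs G v\<close> is the set of edge-ends at \<open>v\<close> (a loop contributes
  two of them). A cyclic order on the finite set \<open>out_arcs G v\<close> is given by its successor
  function.
\<close>

locale ribbon_graph = bidirected_digraph G arev
  for G :: "('a, 'b) pre_digraph" and arev :: "'b \<Rightarrow> 'b" +
  fixes succ :: "'b \<Rightarrow> 'b"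
  assumes succ_cyclic: "\<And>v. v \<in> verts G \<Longrightarrow> out_arcs G v \<noteq> {} \<Longrightarrow> cyclic_on succ (out_arcs G v)"

text \<open>
  In a bidirected digraph the closed walk \<open>[a, arev a]\<close> satisfies \<^const>\<open>pre_digraph.cycle\<close>,
  so the digraph notions \<^const>\<open>forest\<close> and \<^const>\<open>tree\<close> are not the undirected ones. A cycle
  of the undirected graph is one that traverses no edge in both directions.
\<close>

definition (in bidirected_digraph) circuit :: "'b list \<Rightarrow> bool" where
  "circuit p \<longleftrightarrow> cycle p \<and> (\<forall>a \<in> set p. arev a \<notin> set p)"

section \<open>Football graphs and the football tree\<close>

datatype colour = Black | White

locale football_graph = ribbon_graph G arev succ
  for G :: "('a, 'b) pre_digraph" and arev succ :: "'b \<Rightarrow> 'b" +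
  fixes col :: "'a \<Rightarrow> colour"
  assumes connected: "Digraph_Component.connected G"
    and black_valence: "\<And>v. v \<in> verts G \<Longrightarrow> col v = Black \<Longrightarrow> card (out_arcs G v) = 5"
    and black_neighbours: "\<And>a. a \<in> arcs G \<Longrightarrow> col (tail G a) = Black \<Longrightarrow> col (head G a) = White"
    and white_valence: "\<And>v. v \<in> verts G \<Longrightarrow> col v = White \<Longrightarrow> card (out_arcs G v) = 6"
    and white_alternating: "\<And>a. a \<in> arcs G \<Longrightarrow> col (tail G a) = White \<Longrightarrow>
          (col (head G (succ a)) = Black \<longleftrightarrow> col (head G a) = White)"

locale football_tree = football_graph +
  assumes no_circuit: "\<not> (\<exists>p. circuit p)"

section \<open>Orientation-preserving automorphisms\<close>

text \<open>
  An automorphism is a pair of a vertex bijection and a compatible bijection of the edge-ends.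
  Elements of \<^const>\<open>Bij\<close> are undefined outside the given set, so distinct pairs are
  distinct automorphisms.
\<close>

definition auts ::
  "('a, 'b) pre_digraph \<Rightarrow> ('b \<Rightarrow> 'b) \<Rightarrow> ('b \<Rightarrow> 'b) \<Rightarrow> ('a \<Rightarrow> colour) \<Rightarrow> (('a \<Rightarrow> 'a) \<times> ('b \<Rightarrow> 'b)) set"
where
  "auts G arev succ col = {(f, g). f \<in> Bij (verts G) \<and> g \<in> Bij (arcs G) \<and>
     (\<forall>a \<in> arcs G. tail G (g a) = f (tail G a) \<and> head G (g a) = f (head G a) \<and>
        g (arev a) = arev (g a) \<and> g (succ a) = succ (g a)) \<and>
     (\<forall>v \<in> verts G. col (f v) = col v)}"

definition Aut ::
  "('a, 'b) pre_digraph \<Rightarrow> ('b \<Rightarrow> 'b) \<Rightarrow> ('b \<Rightarrow> 'b) \<Rightarrow> ('a \<Rightarrow> colour) \<Rightarrow> (('a \<Rightarrow> 'a) \<times> ('b \<Rightarrow> 'b)) monoid"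
where
  "Aut G arev succ col =
     (BijGroup (verts G) \<times>\<times> BijGroup (arcs G)) \<lparr>carrier := auts G arev succ col\<rparr>"

section \<open>Free products of groups\<close>

definition fp_words :: "'i set \<Rightarrow> ('i \<Rightarrow> ('g, 'm) monoid_scheme) \<Rightarrow> ('i \<times> 'g) list set" where
  "fp_words I H = lists (SIGMA i:I. carrier (H i))"

inductive_set fp_equiv ::
  "'i set \<Rightarrow> ('i \<Rightarrow> ('g, 'm) monoid_scheme) \<Rightarrow> (('i \<times> 'g) list \<times> ('i \<times> 'g) list) set"
  for I :: "'i set" and H :: "'i \<Rightarrow> ('g, 'm) monoid_scheme"
where
  fp_refl: "w \<in> fp_words I H \<Longrightarrow> (w, w) \<in> fp_equiv I H"
| fp_sym: "(v, w) \<in> fp_equiv I H \<Longrightarrow> (w, v) \<in> fp_equiv I H"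
| fp_trans: "(u, v) \<in> fp_equiv I H \<Longrightarrow> (v, w) \<in> fp_equiv I H \<Longrightarrow> (u, w) \<in> fp_equiv I H"
| fp_unit: "u \<in> fp_words I H \<Longrightarrow> v \<in> fp_words I H \<Longrightarrow> i \<in> I \<Longrightarrow>
    (u @ [(i, \<one>\<^bsub>H i\<^esub>)] @ v, u @ v) \<in> fp_equiv I H"
| fp_mult: "u \<in> fp_words I H \<Longrightarrow> v \<in> fp_words I H \<Longrightarrow> i \<in> I \<Longrightarrow>
    a \<in> carrier (H i) \<Longrightarrow> b \<in> carrier (H i) \<Longrightarrow>
    (u @ [(i, a), (i, b)] @ v, u @ [(i, a \<otimes>\<^bsub>H i\<^esub> b)] @ v) \<in> fp_equiv I H"

text \<open>The group of words modulo \<^const>\<open>fp_equiv\<close>, with concatenation as multiplication.\<close>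

definition free_product ::
  "'i set \<Rightarrow> ('i \<Rightarrow> ('g, 'm) monoid_scheme) \<Rightarrow> ('i \<times> 'g) list set monoid"
where
  "free_product I H =
     \<lparr>carrier = fp_words I H // fp_equiv I H,
      monoid.mult = (\<lambda>X Y. \<Union>u \<in> X. \<Union>v \<in> Y. fp_equiv I H `` {u @ v}),
      one = fp_equiv I H `` {[]}\<rparr>"

end

theory Submission
  imports Defs
begin

text \<open>
  Orient the edges between white and black vertices away from white and call the resulting arcs
  spokes. On the set of spokes there are three permutations of order 2, 3 and 5: half a turn about
  the middle of the seam (white-white edge) next to the spoke, a third of a turn about its white
  vertex, and a fifth of a turn about its black vertex. Together they define an action of
  $\mathbb{Z}_2\star\mathbb{Z}_3\star\mathbb{Z}_5$ on the spokes, with words read from left to right.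

  This action is transitive because the graph is connected (\<open>act_transitive\<close>), and free because the
  graph has no circuit (\<open>act_free\<close>). For the latter, a reduced word moving a spoke traces a walk
  through the graph (\<open>word_walk\<close>) which never backtracks; if the word fixes the spoke then the walk
  is closed, and in a tree a closed walk without backtracking is empty
  (\<open>closed_nonbacktracking_imp_circuit\<close>).

  An automorphism of the tree commutes with the three permutations and is determined by its value
  on a single spoke (\<open>orient_hom_eqI\<close>). Conversely, a map of the spokes commuting with them extends
  to all arcs and vertices (\<open>ex_orient_hom_extending\<close>), and as the action is simply transitive there
  is such a map taking any spoke to any other (\<open>ex_orient_hom\<close>). Hence the automorphisms also act
  simply transitively on the spokes. Two commuting simply transitive actions identify the groups
  acting: to an automorphism corresponds the class of the words that move a base spoke to the same
  place as the automorphism does (\<open>iso_free_product\<close>). For actions from opposite sides this is a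
  homomorphism, not an antihomomorphism.
\<close>

section \<open>Words in a free product\<close>

lemma fp_words_Nil [simp]: "[] \<in> fp_words I H"
  and fp_words_Cons [simp]:
    "(i, g) # w \<in> fp_words I H \<longleftrightarrow> i \<in> I \<and> g \<in> carrier (H i) \<and> w \<in> fp_words I H"
  and fp_words_append [simp]:
    "u @ v \<in> fp_words I H \<longleftrightarrow> u \<in> fp_words I H \<and> v \<in> fp_words I H"
  by (auto simp: fp_words_def)

text \<open>
  The relations are stated with an arbitrary context on both sides, which absorbs \<open>p\<close> and \<open>s\<close>.
\<close>

lemma fp_equiv_cong:
  assumes "(u, v) \<in> fp_equiv I H" "p \<in> fp_words I H" "s \<in> fp_words I H"
  shows "(p @ u @ s, p @ v @ s) \<in> fp_equiv I H"
  using assms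
proof (induction rule: fp_equiv.induct)
  case (fp_unit u v i)
  then show ?case using fp_equiv.fp_unit[of "p @ u" I H "v @ s" i] by simp
next
  case (fp_mult u v i a b)
  then show ?case using fp_equiv.fp_mult[of "p @ u" I H "v @ s" i a b] by simp
qed (auto intro: fp_equiv.intros)

definition fp_reduced :: "('i \<Rightarrow> ('g, 'm) monoid_scheme) \<Rightarrow> ('i \<times> 'g) list \<Rightarrow> bool" where
  "fp_reduced H w \<longleftrightarrow>
     successively (\<lambda>x y. fst x \<noteq> fst y) w \<and> (\<forall>(i, g) \<in> set w. g \<noteq> \<one>\<^bsub>H i\<^esub>)"

lemma fp_reduced_Nil [simp]: "fp_reduced H []"
  by (simp add: fp_reduced_def)

lemma fp_reduced_Cons:
  "fp_reduced H ((i, g) # w) \<longleftrightarrow>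
     g \<noteq> \<one>\<^bsub>H i\<^esub> \<and> (w \<noteq> [] \<longrightarrow> fst (hd w) \<noteq> i) \<and> fp_reduced H w"
  by (cases w) (auto simp: fp_reduced_def)

locale group_family =
  fixes I :: "'i set" and H :: "'i \<Rightarrow> ('g, 'm) monoid_scheme"
  assumes group_family: "i \<in> I \<Longrightarrow> group (H i)"
begin

abbreviation "words \<equiv> fp_words I H"
abbreviation fp_eq (infix "\<approx>" 50) where "u \<approx> v \<equiv> (u, v) \<in> fp_equiv I H"

lemma one_in_factor: "i \<in> I \<Longrightarrow> \<one>\<^bsub>H i\<^esub> \<in> carrier (H i)"
  using group_family by (simp add: group.is_monoid)

lemma fp_equiv_words: "u \<approx> v \<Longrightarrow> u \<in> words \<and> v \<in> words"
proof (induction rule: fp_equiv.induct)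
  case (fp_mult u v i a b)
  then interpret group "H i" using group_family by simp
  show ?case using fp_mult by simp
qed (auto simp: one_in_factor)

lemma fp_unit_Cons: "i \<in> I \<Longrightarrow> w \<in> words \<Longrightarrow> (i, \<one>\<^bsub>H i\<^esub>) # w \<approx> w"
  using fp_unit[of "[]" I H w i] by simp

lemma fp_mult_Cons:
  assumes "i \<in> I" "g \<in> carrier (H i)" "h \<in> carrier (H i)" "w \<in> words"
  shows "(i, g) # (i, h) # w \<approx> (i, g \<otimes>\<^bsub>H i\<^esub> h) # w"
  using fp_mult[of "[]" I H w i g h] assms by simp

text \<open>
  Prepending a letter to a reduced word destroys reducedness only if the letter is trivial or
  merges with the first letter of the word, and in both cases one relation repairs it.
\<close>

lemma ex_reduced_word:
  assumes "w \<in> words"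
  shows "\<exists>r. fp_reduced H r \<and> w \<approx> r"
  using assms
proof (induction w)
  case Nil
  then show ?case by (auto intro!: exI[of _ "[]"] fp_refl)
next
  case (Cons x w)
  obtain i g where x: "x = (i, g)" by (cases x)
  with Cons.prems have ig: "i \<in> I" "g \<in> carrier (H i)" and w: "w \<in> words" by auto
  from Cons.IH[OF w] obtain r where r: "fp_reduced H r" "w \<approx> r" by blast
  have rw: "r \<in> words" using fp_equiv_words r(2) by blast
  have xr: "x # w \<approx> (i, g) # r"
    using fp_equiv_cong[OF r(2), of "[x]" "[]"] ig x by simp
  consider "g = \<one>\<^bsub>H i\<^esub>" | "g \<noteq> \<one>\<^bsub>H i\<^esub>" "r \<noteq> [] \<longrightarrow> fst (hd r) \<noteq> i"
    | h s where "r = (i, h) # s" by (metis list.exhaust list.sel(1) prod.collapse)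
  then show ?case
  proof cases
    case 1
    with fp_unit_Cons[OF ig(1) rw] have "(i, g) # r \<approx> r" by simp
    with fp_trans[OF xr] r(1) show ?thesis by (intro exI[of _ r] conjI)
  next
    case 2
    with xr r(1) show ?thesis
      by (intro exI[of _ "(i, g) # r"] conjI) (simp_all add: fp_reduced_Cons)
  next
    case 3
    with rw ig(2) have h: "h \<in> carrier (H i)" and s: "s \<in> words" by auto
    have hs: "x # w \<approx> (i, g \<otimes>\<^bsub>H i\<^esub> h) # s"
      using fp_trans[OF xr] fp_mult_Cons[OF ig h s] 3 by simp
    show ?thesis
    proof (cases "g \<otimes>\<^bsub>H i\<^esub> h = \<one>\<^bsub>H i\<^esub>")
      case True
      with fp_unit_Cons[OF ig(1) s] have "(i, g \<otimes>\<^bsub>H i\<^esub> h) # s \<approx> s" by simp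
      with fp_trans[OF hs] r(1) 3 show ?thesis
        by (intro exI[of _ s] conjI) (simp_all add: fp_reduced_Cons)
    next
      case False
      with hs r(1) 3 show ?thesis
        by (intro exI[of _ "(i, g \<otimes>\<^bsub>H i\<^esub> h) # s"] conjI) (simp_all add: fp_reduced_Cons)
    qed
  qed
qed

text \<open>
  Invert the letters and reverse their order. The two words then cancel from the middle, which
  gives the inverse needed to turn an equality of two positions into a fixed point.
\<close>

lemma ex_inverse_word:
  assumes "w \<in> words"
  shows "\<exists>w' \<in> words. w @ w' \<approx> [] \<and> w' @ w \<approx> []"
  using assms
proof (induction w)
  case Nil
  then show ?case by (auto intro!: bexI[of _ "[]"] fp_refl)
next
  case (Cons x w)
  obtain i g where x: "x = (i, g)" by (cases x)
  with Cons.prems have ig: "i \<in> I" "g \<in> carrier (H i)" and w: "w \<in> words" by auto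
  from Cons.IH[OF w] obtain v where v: "v \<in> words" "w @ v \<approx> []" "v @ w \<approx> []" by blast
  interpret group "H i" using group_family ig(1) .
  let ?y = "(i, inv\<^bsub>H i\<^esub> g)"
  have y: "[?y] \<in> words" using ig by simp
  have xy: "[x, ?y] \<approx> []" and yx: "[?y, x] \<approx> []"
    using fp_mult_Cons[of i g "inv\<^bsub>H i\<^esub> g" "[]"] fp_mult_Cons[of i "inv\<^bsub>H i\<^esub> g" g "[]"]
      fp_unit_Cons[of i "[]"] ig x by (simp_all add: fp_trans[of _ "[(i, \<one>\<^bsub>H i\<^esub>)]"])
  have "(x # w) @ v @ [?y] \<approx> []"
    using fp_trans[OF _ xy] fp_equiv_cong[OF v(2), of "[x]" "[?y]"] y ig x by simp
  moreover have "(v @ [?y]) @ x # w \<approx> []"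
    using fp_trans[OF _ v(3)] fp_equiv_cong[OF yx, of v w] v(1) w by simp
  ultimately show ?case using v(1) y by (intro bexI[of _ "v @ [?y]"]) auto
qed

end

section \<open>Free products acting on sets\<close>

primrec word_act :: "('i \<Rightarrow> 'g \<Rightarrow> 'x \<Rightarrow> 'x) \<Rightarrow> 'x \<Rightarrow> ('i \<times> 'g) list \<Rightarrow> 'x" where
  "word_act P x [] = x"
| "word_act P x (l # w) = word_act P (P (fst l) (snd l) x) w"

lemma word_act_append: "word_act P x (u @ v) = word_act P (word_act P x u) v"
  by (induction u arbitrary: x) auto

locale word_action = group_family I H
  for I :: "'i set" and H :: "'i \<Rightarrow> ('g, 'm) monoid_scheme" +
  fixes X :: "'x set" and P :: "'i \<Rightarrow> 'g \<Rightarrow> 'x \<Rightarrow> 'x"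
  assumes letter_closed: "i \<in> I \<Longrightarrow> g \<in> carrier (H i) \<Longrightarrow> x \<in> X \<Longrightarrow> P i g x \<in> X"
    and letter_one: "i \<in> I \<Longrightarrow> x \<in> X \<Longrightarrow> P i \<one>\<^bsub>H i\<^esub> x = x"
    and letter_mult: "i \<in> I \<Longrightarrow> g \<in> carrier (H i) \<Longrightarrow> h \<in> carrier (H i) \<Longrightarrow> x \<in> X \<Longrightarrow>
      P i (g \<otimes>\<^bsub>H i\<^esub> h) x = P i h (P i g x)"
begin

abbreviation "act \<equiv> word_act P"

lemma act_closed: "w \<in> words \<Longrightarrow> x \<in> X \<Longrightarrow> act x w \<in> X"
  by (induction w arbitrary: x) (auto simp: letter_closed)

lemma act_fp_equiv: "u \<approx> v \<Longrightarrow> x \<in> X \<Longrightarrow> act x u = act x v"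
proof (induction arbitrary: x rule: fp_equiv.induct)
  case (fp_unit u v i)
  then show ?case by (simp add: word_act_append letter_one act_closed)
next
  case (fp_mult u v i a b)
  then show ?case by (simp add: word_act_append letter_mult act_closed)
qed auto

text \<open>
  Since every word has a reduced representative, reduced words suffice to test that stabilisers
  are trivial; two words that move \<open>x\<close> to the same point then differ by a word fixing \<open>x\<close>.
\<close>

lemma free_act_iff:
  assumes free: "\<And>w. w \<in> words \<Longrightarrow> fp_reduced H w \<Longrightarrow> act x w = x \<Longrightarrow> w = []"
    and x: "x \<in> X" and uv: "u \<in> words" "v \<in> words"
  shows "act x u = act x v \<longleftrightarrow> u \<approx> v"
proof
  assume eq: "act x u = act x v"
  obtain v' where v': "v' \<in> words" "v @ v' \<approx> []" "v' @ v \<approx> []"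
    using ex_inverse_word[OF uv(2)] by blast
  obtain r where r: "fp_reduced H r" "u @ v' \<approx> r"
    using ex_reduced_word[of "u @ v'"] uv v' by auto
  have "act x r = act x (u @ v')" using act_fp_equiv[OF r(2) x] by simp
  also have "\<dots> = act x (v @ v')" by (simp add: word_act_append eq)
  also have "\<dots> = x" using act_fp_equiv[OF v'(2) x] by simp
  finally have "r = []" using free r fp_equiv_words by blast
  with r(2) have "u @ v' \<approx> []" by simp
  then have "u @ v' @ v \<approx> v" using fp_equiv_cong[of "u @ v'" "[]" I H "[]" v] uv by simp
  moreover have "u @ v' @ v \<approx> u" using fp_equiv_cong[OF v'(3), of u "[]"] uv by simp
  ultimately show "u \<approx> v" by (rule fp_trans[OF fp_sym, rotated])
qed (use act_fp_equiv x in blast)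

text \<open>
  Since the action is simply transitive, the words that move the base point \<open>x\<close> to a given
  point form exactly one class of the free product, so a bijection \<open>ev\<close> onto \<open>X\<close> turns elements
  of \<open>G\<close> into classes. The intended \<open>ev a\<close> is the image of \<open>x\<close> under \<open>a\<close>, for an action of \<open>G\<close>
  on the left that commutes with the action of words on the right. The condition on \<open>\<otimes>\<close> is what
  is left of this: \<open>a (b x) = a (x w) = (a x) w\<close>. It makes the bijection multiplicative.
\<close>

theorem iso_free_product:
  fixes G (structure)
  assumes x: "x \<in> X"
    and free: "\<And>w. w \<in> words \<Longrightarrow> fp_reduced H w \<Longrightarrow> act x w = x \<Longrightarrow> w = []"
    and trans: "\<And>y. y \<in> X \<Longrightarrow> \<exists>w \<in> words. act x w = y"
    and ev: "bij_betw ev (carrier G) X"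
    and closed: "\<And>a b. a \<in> carrier G \<Longrightarrow> b \<in> carrier G \<Longrightarrow> a \<otimes> b \<in> carrier G"
    and mult: "\<And>a b w. a \<in> carrier G \<Longrightarrow> b \<in> carrier G \<Longrightarrow> w \<in> words \<Longrightarrow> ev b = act x w \<Longrightarrow>
      ev (a \<otimes> b) = act (ev a) w"
  shows "G \<cong> free_product I H"
proof -
  define \<Theta> where "\<Theta> a = {w \<in> words. act x w = ev a}" for a
  note free_iff = free_act_iff[OF free x]
  have evX: "ev a \<in> X" if "a \<in> carrier G" for a
    using ev that by (rule bij_betwE[rule_format])
  have \<Theta>_class: "\<Theta> a = fp_equiv I H `` {w}" if "w \<in> words" "act x w = ev a" for a w
  proof -
    have "v \<in> \<Theta> a \<longleftrightarrow> w \<approx> v" for v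
      using that free_iff[of w v] fp_equiv_words[of w v] unfolding \<Theta>_def mem_Collect_eq by metis
    then show ?thesis by blast
  qed
  have ex: "\<exists>w \<in> words. act x w = ev a" if "a \<in> carrier G" for a
    using trans evX that by blast
  have "\<Theta> (a \<otimes> b) = \<Theta> a \<otimes>\<^bsub>free_product I H\<^esub> \<Theta> b"
    if ab: "a \<in> carrier G" "b \<in> carrier G" for a b
  proof -
    have "fp_equiv I H `` {u @ v} = \<Theta> (a \<otimes> b)" if "u \<in> \<Theta> a" "v \<in> \<Theta> b" for u v
      using that ab \<Theta>_class[of "u @ v" "a \<otimes> b"] mult[of a b v]
      by (auto simp: \<Theta>_def word_act_append)
    moreover have "\<Theta> a \<noteq> {}" "\<Theta> b \<noteq> {}" using ex ab by (auto simp: \<Theta>_def)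
    ultimately show ?thesis by (auto simp: free_product_def)
  qed
  moreover have "\<Theta> ` carrier G = carrier (free_product I H)"
  proof
    show "\<Theta> ` carrier G \<subseteq> carrier (free_product I H)"
      using ex \<Theta>_class by (fastforce simp: free_product_def quotient_def)
    show "carrier (free_product I H) \<subseteq> \<Theta> ` carrier G"
    proof
      fix C assume "C \<in> carrier (free_product I H)"
      then obtain w where w: "w \<in> words" "C = fp_equiv I H `` {w}"
        by (auto simp: free_product_def quotient_def)
      obtain a where "a \<in> carrier G" "ev a = act x w"
        using ev act_closed[OF w(1) x] by (auto simp: bij_betw_def)
      moreover have "\<Theta> a = C" using \<Theta>_class[OF w(1), of a] w(2) \<open>ev a = act x w\<close> by simp
      ultimately show "C \<in> \<Theta> ` carrier G" by blast
    qed
  qed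
  moreover have "inj_on \<Theta> (carrier G)"
  proof (rule inj_onI)
    fix a b assume ab: "a \<in> carrier G" "b \<in> carrier G" "\<Theta> a = \<Theta> b"
    obtain w where w: "w \<in> words" "act x w = ev a" using ex ab(1) by blast
    then have "w \<in> \<Theta> a" by (simp add: \<Theta>_def)
    with ab(3) have "w \<in> \<Theta> b" by simp
    with w have "ev a = ev b" by (simp add: \<Theta>_def)
    with ab ev show "a = b" by (auto simp: bij_betw_def inj_on_def)
  qed
  ultimately have "\<Theta> \<in> iso G (free_product I H)"
    by (auto simp: iso_def hom_def bij_betw_def)
  then show ?thesis by (auto simp: is_iso_def)
qed

end

section \<open>Walks without backtracking\<close>

context bidirected_digraph
begin

definition nonbacktracking :: "'b list \<Rightarrow> bool" where
  "nonbacktracking p \<longleftrightarrow> successively (\<lambda>e f. f \<noteq> arev e) p"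

lemma nonbacktracking_Nil [simp]: "nonbacktracking []"
  by (simp add: nonbacktracking_def)

lemma nonbacktracking_Cons:
  "nonbacktracking (e # p) \<longleftrightarrow> (p \<noteq> [] \<longrightarrow> hd p \<noteq> arev e) \<and> nonbacktracking p"
  by (cases p) (auto simp: nonbacktracking_def)

text \<open>
  Suppose that \<open>p\<close> runs through \<open>e\<close> and later through its reverse. The arc \<open>f\<close> before the reverse
  ends where \<open>e\<close> ends, and the walk visits this vertex only once, so \<open>f\<close> is \<open>e\<close> itself. The walk
  thus turns back immediately after \<open>e\<close>.
\<close>

lemma nonbacktracking_cycle_is_circuit:
  assumes "awalk u p u" "distinct (tl (awalk_verts u p))" "p \<noteq> []" "nonbacktracking p"
  shows "circuit p"
proof -
  have cyc: "cycle p" using assms by (auto simp: cycle_def)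
  have "distinct (map (head G) p)"
    using assms by (auto simp: awalk_verts_conv' elim!: awalkE')
  then have inj: "inj_on (head G) (set p)" by (simp add: distinct_map)
  have "distinct p" using assms distinct_tl_verts_imp_distinct by blast
  have "False" if e: "e \<in> set p" "arev e \<in> set p" for e
  proof -
    have earc: "e \<in> arcs G" using e assms by auto
    \<comment> \<open>Needed for \<open>e\<close> and also for its reverse, as either of them may come first in \<open>p\<close>.\<close>
    have aux: False if p: "p = xs @ e # ys @ arev e # zs" and earc: "e \<in> arcs G" for xs ys zs e
    proof (cases ys rule: rev_cases)
      case Nil
      then show False using assms(4) p
        by (simp add: nonbacktracking_def successively_append_iff)
    next
      case (snoc ys' f)
      have "head G f = tail G (arev e)"
        using assms(1) p snoc by (auto simp: awalk_verts_conv awalk_Cons_iff)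
      then have "head G f = head G e" using earc by simp
      then have "f = e" using inj p snoc by (elim inj_onD) simp_all
      with p snoc \<open>distinct p\<close> show False by simp
    qed
    have "e \<noteq> arev e" using arev_neq earc by metis
    obtain xs zs where p: "p = xs @ e # zs" using e(1) by (auto dest: split_list)
    consider "arev e \<in> set xs" | "arev e \<in> set zs" using e(2) p \<open>e \<noteq> arev e\<close> by auto
    then show False
    proof cases
      case 1
      then obtain as bs where "xs = as @ arev e # bs" by (auto dest: split_list)
      then show False using aux[of as "arev e" bs zs] p earc by simp
    next
      case 2
      then obtain as bs where "zs = as @ arev e # bs" by (auto dest: split_list)
      then show False using aux[of xs e as bs] p earc by simp
    qed
  qed
  with cyc show ?thesis by (auto simp: circuit_def)
qed

text \<open>
  A shortest nonempty closed part of the walk has no repeated vertex, and being a contiguous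
  part it does not backtrack either.
\<close>

lemma closed_nonbacktracking_imp_circuit:
  assumes "awalk u p u" "p \<noteq> []" "nonbacktracking p"
  shows "\<exists>p. circuit p"
  using assms
proof (induction "length p" arbitrary: u p rule: less_induct)
  case less
  show ?case
  proof (cases "distinct (tl (awalk_verts u p))")
    case True
    then show ?thesis using nonbacktracking_cycle_is_circuit less.prems by blast
  next
    case False
    obtain e es where p: "p = e # es" using less.prems by (cases p) auto
    have "awalk (head G e) es u" using less.prems(1) unfolding p awalk_Cons_iff by blast
    moreover have "\<not> distinct (awalk_verts (head G e) es)" using False p by simp
    ultimately obtain q r s w where es: "es = q @ r @ s" "awalk w r w" "0 < length r"
      by (metis awalk_not_distinct_decomp)
    have "nonbacktracking r"
      using less.prems(3) unfolding p es nonbacktracking_def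
      by (simp only: successively_append_iff append_Cons[symmetric])
    then show ?thesis using less.hyps[of r w] es p by simp
  qed
qed

end

section \<open>Rotations of a football graph\<close>

lemma cyclic_on_funpow_period:
  assumes "cyclic_on f S" "s \<in> S"
  shows "(f ^^ card S) s = s" "0 < n \<Longrightarrow> n < card S \<Longrightarrow> (f ^^ n) s \<noteq> s"
proof -
  have S: "orbit f s = S" using orbit_cyclic_eq3[OF assms] .
  then have s: "s \<in> orbit f s" using assms by simp
  then have "card S = funpow_dist1 f s s"
    using orbit_conv_funpow_dist1[OF s] inj_on_funpow_dist1[OF s] S by (simp add: card_image)
  then show "(f ^^ card S) s = s" "0 < n \<Longrightarrow> n < card S \<Longrightarrow> (f ^^ n) s \<noteq> s"
    using funpow_dist1_prop[OF s] funpow_dist1_least[of n f s s] by simp_all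
qed

context football_graph
begin

lemma out_arcs_orbit: "a \<in> arcs G \<Longrightarrow> out_arcs G (tail G a) = orbit succ a"
  using succ_cyclic[of "tail G a"] orbit_cyclic_eq3[of succ "out_arcs G (tail G a)" a]
  by (auto simp: out_arcs_def)

lemma succ_arc [simp]:
  assumes "a \<in> arcs G"
  shows "succ a \<in> arcs G" "tail G (succ a) = tail G a"
proof -
  have "succ a \<in> out_arcs G (tail G a)"
    unfolding out_arcs_orbit[OF assms] by (rule orbit.base)
  then show "succ a \<in> arcs G" "tail G (succ a) = tail G a" by (simp_all add: out_arcs_def)
qed

lemma succ_funpow_arc [simp]:
  assumes "a \<in> arcs G"
  shows "(succ ^^ n) a \<in> arcs G" "tail G ((succ ^^ n) a) = tail G a"
  using assms by (induction n) simp_all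

lemma succ_period:
  assumes "a \<in> arcs G" "card (out_arcs G (tail G a)) = m"
  shows "(succ ^^ m) a = a" "0 < n \<Longrightarrow> n < m \<Longrightarrow> (succ ^^ n) a \<noteq> a"
proof -
  have a: "a \<in> out_arcs G (tail G a)" using assms by (simp add: out_arcs_def)
  have "cyclic_on succ (out_arcs G (tail G a))" using succ_cyclic[of "tail G a"] a assms(1) by fastforce
  from cyclic_on_funpow_period(1)[OF this a] cyclic_on_funpow_period(2)[OF this a, of n]
  show "(succ ^^ m) a = a" "0 < n \<Longrightarrow> n < m \<Longrightarrow> (succ ^^ n) a \<noteq> a"
    unfolding assms(2) by blast+
qed

lemma not_Black_iff: "c \<noteq> Black \<longleftrightarrow> c = White"
  by (cases c) auto

text \<open>
  Around a white vertex, edges to black vertices (spokes) alternate with edges to white vertices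
  (seams). Every edge-end is a spoke, a reversed spoke, or the successor of exactly one spoke, so
  a map of the spokes leaves no choice for its extension to the other arcs.
\<close>

definition spokes :: "'b set" where
  "spokes = {a \<in> arcs G. col (tail G a) = White \<and> col (head G a) = Black}"

definition seams :: "'b set" where
  "seams = {a \<in> arcs G. col (tail G a) = White \<and> col (head G a) = White}"

lemma spoke_arc: "a \<in> spokes \<Longrightarrow> a \<in> arcs G"
  and seam_arc: "a \<in> seams \<Longrightarrow> a \<in> arcs G"
  by (auto simp: spokes_def seams_def)

lemma spoke_colours: "a \<in> spokes \<Longrightarrow> col (tail G a) = White"
    "a \<in> spokes \<Longrightarrow> col (head G a) = Black"
  and seam_colours: "a \<in> seams \<Longrightarrow> col (tail G a) = White"
    "a \<in> seams \<Longrightarrow> col (head G a) = White"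
  by (auto simp: spokes_def seams_def)

lemma spoke_not_seam: "a \<in> spokes \<Longrightarrow> a \<notin> seams"
  by (auto simp: spokes_def seams_def)

lemma arcs_cases:
  assumes "a \<in> arcs G"
  obtains "a \<in> spokes" | "a \<in> seams" | "arev a \<in> spokes"
  using assms black_neighbours[OF assms]
  by (cases "col (tail G a)"; cases "col (head G a)") (auto simp: spokes_def seams_def)

lemma arev_spoke_not_white: "arev a \<in> spokes \<Longrightarrow> a \<notin> spokes \<and> a \<notin> seams"
  using arev_in_arcs[of "arev a"] by (auto simp: spokes_def seams_def)

lemma succ_spoke: "a \<in> spokes \<Longrightarrow> succ a \<in> seams"
  using white_alternating[of a] by (auto simp: spokes_def seams_def not_Black_iff)

lemma succ_seam: "a \<in> seams \<Longrightarrow> succ a \<in> spokes"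
  using white_alternating[of a] by (auto simp: spokes_def seams_def)

lemma arev_seam: "a \<in> seams \<Longrightarrow> arev a \<in> seams"
  by (auto simp: seams_def)

text \<open>A white vertex has valence six, so the fifth successor of a seam precedes it.\<close>

definition pred :: "'b \<Rightarrow> 'b" where
  "pred c = (succ ^^ 5) c"

lemma white_period:
  assumes "a \<in> spokes \<union> seams"
  shows "(succ ^^ 6) a = a" "0 < n \<Longrightarrow> n < 6 \<Longrightarrow> (succ ^^ n) a \<noteq> a"
proof -
  have "card (out_arcs G (tail G a)) = 6"
    using assms by (intro white_valence) (auto simp: spokes_def seams_def)
  moreover have "a \<in> arcs G" using assms spoke_arc seam_arc by blast
  ultimately show "(succ ^^ 6) a = a" "0 < n \<Longrightarrow> n < 6 \<Longrightarrow> (succ ^^ n) a \<noteq> a"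
    using succ_period by auto
qed

lemma black_period:
  assumes "arev a \<in> spokes"
  shows "(succ ^^ 5) a = a" "0 < n \<Longrightarrow> n < 5 \<Longrightarrow> (succ ^^ n) a \<noteq> a"
proof -
  have a: "a \<in> arcs G" using spoke_arc[OF assms] arev_in_arcs[of "arev a"] by simp
  then have "card (out_arcs G (tail G a)) = 5"
    using assms by (intro black_valence) (auto simp: spokes_def)
  with a show "(succ ^^ 5) a = a" "0 < n \<Longrightarrow> n < 5 \<Longrightarrow> (succ ^^ n) a \<noteq> a"
    using succ_period by auto
qed

lemma pred_succ: "a \<in> spokes \<Longrightarrow> pred (succ a) = a"
  and succ_pred: "a \<in> seams \<Longrightarrow> succ (pred a) = a"
  using white_period(1)[of a] by (auto simp: pred_def eval_nat_numeral)

lemma pred_seam: "a \<in> seams \<Longrightarrow> pred a \<in> spokes"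
  by (simp add: pred_def eval_nat_numeral succ_spoke succ_seam)

lemma arev_black: "arev a \<in> spokes \<Longrightarrow> arev (succ a) \<in> spokes"
proof -
  assume a: "arev a \<in> spokes"
  then have "a \<in> arcs G" using spoke_arc[OF a] arev_in_arcs[of "arev a"] by simp
  with a show ?thesis using black_neighbours[of "succ a"] by (auto simp: spokes_def)
qed

declare spoke_arc [simp] seam_arc [simp]

text \<open>
  The three rotations of a football: half a turn about the middle of the seam that follows the
  spoke, a third of a turn about its white vertex, a fifth of a turn about its black vertex. They
  are permutations of the spokes, not automorphisms of the graph; like the right translations of
  a group they commute with all automorphisms.
\<close>

definition turn :: "nat \<Rightarrow> 'b \<Rightarrow> 'b" where
  "turn i a = (if i = 2 then pred (arev (succ a)) else if i = 3 then succ (succ a)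
     else arev (succ (arev a)))"

lemma turn_spoke: "a \<in> spokes \<Longrightarrow> turn i a \<in> spokes"
  by (auto simp: turn_def succ_spoke succ_seam pred_seam arev_seam arev_black)

lemma turn_funpow_spoke: "a \<in> spokes \<Longrightarrow> (turn i ^^ n) a \<in> spokes"
  by (induction n) (simp_all add: turn_spoke)

lemma turn3_funpow: "(turn 3 ^^ n) a = (succ ^^ (2 * n)) a"
  by (induction n) (simp_all add: turn_def)

lemma turn5_funpow: "(turn 5 ^^ n) a = arev ((succ ^^ n) (arev a))"
  by (induction n) (simp_all add: turn_def)

lemma succ_turn2: "a \<in> spokes \<Longrightarrow> succ (turn 2 a) = arev (succ a)"
  by (simp add: turn_def succ_pred arev_seam succ_spoke)

lemma turn_period:
  assumes "i \<in> {2, 3, 5}" "a \<in> spokes"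
  shows "(turn i ^^ i) a = a"
proof -
  have "turn 2 (turn 2 a) = pred (succ a)"
    by (subst turn_def) (simp add: succ_turn2 assms)
  with assms show ?thesis
    using white_period(1)[of a] black_period(1)[of "arev a"]
    by (auto simp: turn3_funpow turn5_funpow pred_succ numeral_2_eq_2)
qed

definition turn_by :: "nat \<Rightarrow> int \<Rightarrow> 'b \<Rightarrow> 'b" where
  "turn_by i k = turn i ^^ nat k"

lemma turn_by_1 [simp]: "turn_by i 1 = turn i"
  by (simp add: turn_by_def)

text \<open>
  The rotation of index \<open>i\<close> has order dividing \<open>i\<close>, so exponents may be read modulo \<open>i\<close>.
\<close>

lemma word_action_turn_by: "word_action {2, 3, 5} integer_mod_group spokes turn_by"
proof (intro word_action.intro word_action_axioms.intro group_family.intro)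
  fix i :: nat and g h :: int and x
  assume i: "i \<in> {2, 3, 5}"
  show "turn_by i g x \<in> spokes" if "x \<in> spokes"
    using that by (simp add: turn_by_def turn_funpow_spoke)
  show "turn_by i \<one>\<^bsub>integer_mod_group i\<^esub> x = x" by (simp add: turn_by_def)
  assume g: "g \<in> carrier (integer_mod_group i)" "h \<in> carrier (integer_mod_group i)"
    and x: "x \<in> spokes"
  have pos: "0 \<le> g" "0 \<le> h" using g i by (auto simp: carrier_integer_mod_group)
  have "nat ((g + h) mod int i) = (nat h + nat g) mod i"
    using pos by (simp add: nat_mod_distrib nat_add_distrib add.commute)
  then have "turn_by i (g \<otimes>\<^bsub>integer_mod_group i\<^esub> h) x = (turn i ^^ (nat h + nat g)) x"
    using funpow_mod_eq[OF turn_period[OF i x]] by (simp add: turn_by_def)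
  then show "turn_by i (g \<otimes>\<^bsub>integer_mod_group i\<^esub> h) x = turn_by i h (turn_by i g x)"
    by (simp add: turn_by_def funpow_add)
qed simp_all

sublocale rotations: word_action "{2, 3, 5}" integer_mod_group spokes turn_by
  by (rule word_action_turn_by)

abbreviation "words \<equiv> fp_words {2, 3, 5 :: nat} integer_mod_group"
abbreviation "act \<equiv> word_act turn_by"

text \<open>
  All arcs at a vertex are reached from any one of them by rotation, and reversing an arc leads
  to the neighbouring vertex, so connectedness carries a property from one arc to all others.
\<close>

lemma arcs_induct [consumes 2, case_names base succ arev]:
  assumes a: "a \<in> arcs G" and e: "e \<in> arcs G"
    and base: "Q a"
    and succ: "\<And>e. e \<in> arcs G \<Longrightarrow> Q e \<Longrightarrow> Q (succ e)"
    and arev: "\<And>e. e \<in> arcs G \<Longrightarrow> Q e \<Longrightarrow> Q (arev e)"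
  shows "Q e"
proof -
  have star: "Q e'" if e: "e \<in> arcs G" "Q e" and e': "e' \<in> out_arcs G (tail G e)" for e e'
  proof -
    have "e' \<in> orbit succ e" using e' out_arcs_orbit[OF e(1)] by simp
    then have "e' \<in> arcs G \<and> Q e'"
      by induction (use e succ in auto)
    then show ?thesis by simp
  qed
  have "tail G a \<rightarrow>\<^sup>*\<^bsub>G\<^esub> tail G e"
    using symmetric_connected_imp_strongly_connected[OF sym_arcs connected] a e
    by (simp add: strongly_connected_def)
  then have "\<forall>e' \<in> out_arcs G (tail G e). Q e'"
  proof (induction rule: reachable_induct)
    case base
    then show ?case using star[OF a assms(3)] by blast
  next
    case (step x y)
    obtain c where c: "c \<in> arcs G" "tail G c = x" "head G c = y" using step(2) by auto
    then have "Q (arev c)" using step(3) arev by (simp add: out_arcs_def)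
    then show ?case using star[of "arev c"] c by auto
  qed
  then show ?thesis using e by (simp add: out_arcs_def)
qed

lemma ex_out_arc:
  assumes "v \<in> verts G"
  obtains a where "a \<in> arcs G" "tail G a = v"
proof -
  have "card (out_arcs G v) \<noteq> 0"
    using assms black_valence white_valence by (cases "col v") auto
  then show ?thesis using that by (metis card.empty ex_in_conv in_out_arcs_conv)
qed

lemma spokes_nonempty: "spokes \<noteq> {}"
proof -
  obtain v where "v \<in> verts G" using connected connected_conv[of G] by auto
  then obtain a where "a \<in> arcs G" by (rule ex_out_arc)
  then show ?thesis by (cases rule: arcs_cases) (use succ_seam in auto)
qed

text \<open>
  Rotating or reversing an arc \<open>e\<close> either leaves the spoke that represents it unchanged or
  applies one of the three rotations to it. Transitivity on the spokes thus follows from the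
  generation of all arcs by these two operations.
\<close>

definition spoke_of :: "'b \<Rightarrow> 'b" where
  "spoke_of e = (if e \<in> spokes then e else if e \<in> seams then pred e else arev e)"

lemma spoke_of_simps [simp]:
  "e \<in> spokes \<Longrightarrow> spoke_of e = e"
  "e \<in> seams \<Longrightarrow> spoke_of e = pred e"
  "arev e \<in> spokes \<Longrightarrow> spoke_of e = arev e"
  using spoke_not_seam[of e] arev_spoke_not_white[of e] by (auto simp: spoke_of_def)

lemma act_transitive:
  assumes a: "a \<in> spokes" and b: "b \<in> spokes"
  shows "\<exists>w \<in> words. act a w = b"
proof -
  define R where "R = {act a w | w. w \<in> words}"
  have turn: "turn i x \<in> R" if i: "i \<in> {2, 3, 5}" and x: "x \<in> R" for i x
  proof -
    obtain w where w: "w \<in> words" "x = act a w" using x by (auto simp: R_def)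
    have "turn i x = act a (w @ [(i, 1)])" by (simp add: w word_act_append turn_by_def)
    moreover have "w @ [(i, 1)] \<in> words" using w i by auto
    ultimately show ?thesis unfolding R_def by blast
  qed
  have "act a [] \<in> R" unfolding R_def using fp_words_Nil by blast
  then have "a \<in> R" by simp
  have "spoke_of b \<in> R"
    using spoke_arc[OF a] spoke_arc[OF b]
  proof (induction rule: arcs_induct)
    case base
    then show ?case using a \<open>a \<in> R\<close> by simp
  next
    case (succ e)
    from succ(1) show ?case
    proof (cases rule: arcs_cases)
      case 1
      then show ?thesis using succ(2) by (simp add: succ_spoke pred_succ)
    next
      case 2
      then have "succ e = turn 3 (pred e)" by (simp add: turn_def succ_pred)
      then show ?thesis using succ_seam[OF 2] 2 succ(2) turn[of 3 "pred e"] by simp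
    next
      case 3
      then have "arev (succ e) = turn 5 (arev e)" by (simp add: turn_def)
      then show ?thesis using arev_black[OF 3] 3 succ(2) turn[of 5 "arev e"] by simp
    qed
  next
    case (arev e)
    from arev(1) show ?case
    proof (cases rule: arcs_cases)
      case 2
      then have "pred (arev e) = turn 2 (pred e)" by (simp add: turn_def succ_pred)
      then show ?thesis using 2 arev(2) turn[of 2 "pred e"] by (simp add: arev_seam)
    qed (use arev(2) in simp_all)
  qed
  then show ?thesis using b by (auto simp: R_def)
qed

section \<open>Freeness of the action on the football tree\<close>

text \<open>
  The arcs traversed when a word moves a spoke: a half turn crosses the seam, a rotation about the
  black vertex goes there and back along another spoke, and a rotation about the white vertex
  stays in place.
\<close>

primrec word_walk :: "'b \<Rightarrow> (nat \<times> int) list \<Rightarrow> 'b list" where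
  "word_walk a [] = []"
| "word_walk a (l # w) =
     (let b = turn_by (fst l) (snd l) a
      in (if fst l = 2 then [succ a] else if fst l = 3 then [] else [a, arev b]) @ word_walk b w)"

lemma turn_by_neq:
  assumes "i \<in> {3, 5}" "k \<in> carrier (integer_mod_group i)" "k \<noteq> 0" "a \<in> spokes"
  shows "turn_by i k a \<noteq> a"
proof (cases "i = 3")
  case True
  then show ?thesis using assms white_period(2)[of a "2 * nat k"]
    by (auto simp: turn_by_def turn3_funpow carrier_integer_mod_group nat_less_iff)
next
  case False
  then have "(succ ^^ nat k) (arev a) \<noteq> arev a"
    using assms black_period(2)[of "arev a" "nat k"]
    by (auto simp: carrier_integer_mod_group nat_less_iff)
  then have "arev ((succ ^^ nat k) (arev a)) \<noteq> a" by (metis arev_arev)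
  then show ?thesis using False assms by (auto simp: turn_by_def turn5_funpow)
qed

lemma head_turn_by_5: "a \<in> spokes \<Longrightarrow> head G (turn_by 5 k a) = head G a"
  by (simp add: turn_by_def turn5_funpow)

lemma tail_turn_by_3: "a \<in> spokes \<Longrightarrow> tail G (turn_by 3 k a) = tail G a"
  by (simp add: turn_by_def turn3_funpow)

text \<open>
  At a black vertex the walk does not backtrack, because a nontrivial rotation changes the spoke.
  It remains to look at a white vertex, between the arcs of two consecutive movements.
  The walk arrives at the current spoke \<open>b\<close> through the reverse of \<open>b\<close> or of \<open>succ b\<close>. Since the next
  letter has a different index, the walk leaves through the other of these two arcs, or it first
  turns about the white vertex and leaves through neither. The last conjunct, on the first arc of
  the walk, is what makes this work in the induction.
\<close>

lemma word_walk_nonbacktracking: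
  assumes "w \<in> words" "fp_reduced integer_mod_group w" "a \<in> spokes"
  shows "awalk (tail G a) (word_walk a w) (tail G (act a w)) \<and> nonbacktracking (word_walk a w) \<and>
    (word_walk a w \<noteq> [] \<longrightarrow>
      (if fst (hd w) = 2 then hd (word_walk a w) = succ a
       else if fst (hd w) = 3 then hd (word_walk a w) \<notin> {a, succ a}
       else hd (word_walk a w) = a))"
  using assms
proof (induction w arbitrary: a)
  case Nil
  then show ?case by (simp add: awalk_Nil_iff)
next
  case (Cons l w)
  obtain i k where l: "l = (i, k)" by (cases l)
  define b where "b = turn_by i k a"
  have i: "i \<in> {2, 3, 5}" and k: "k \<in> carrier (integer_mod_group i)" "k \<noteq> 0"
    and w: "w \<in> words" "fp_reduced integer_mod_group w" "w \<noteq> [] \<Longrightarrow> fst (hd w) \<noteq> i"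
    using Cons.prems(1,2) by (simp_all add: l fp_reduced_Cons)
  have a: "a \<in> spokes" by (rule Cons.prems)
  have b: "b \<in> spokes" unfolding b_def by (rule rotations.letter_closed[OF i k(1) a])
  have neq: "succ b \<noteq> b" "succ a \<noteq> a" "succ a \<noteq> b" "succ b \<noteq> a"
    using a b succ_spoke spoke_not_seam by metis+
  have sa: "succ a \<in> arcs G" "tail G (succ a) = tail G a" using a by simp_all
  let ?W = "word_walk b w"
  have walk: "awalk (tail G b) ?W (tail G (act b w))" and nb: "nonbacktracking ?W"
    and hd: "?W \<noteq> [] \<Longrightarrow> (if fst (hd w) = 2 then hd ?W = succ b
      else if fst (hd w) = 3 then hd ?W \<notin> {b, succ b} else hd ?W = b)"
    using Cons.IH[OF w(1,2) b] by blast+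
  have ne: "w \<noteq> []" if "?W \<noteq> []" using that by auto
  have hd_w: "fst (hd w) \<in> {2, 3, 5}" if "w \<noteq> []" using that w(1) by (cases w) auto
  have act: "act a (l # w) = act b w" by (simp add: l b_def)
  consider "i = 2" | "i = 3" | "i = 5" using i by blast
  then show ?case
  proof cases
    case 1
    then have "k = 1" using k by (auto simp: carrier_integer_mod_group)
    then have sb: "succ b = arev (succ a)" using a 1 by (simp add: b_def turn_by_def succ_turn2)
    have "tail G b = tail G (succ b)" using b by simp
    then have tb: "tail G b = head G (succ a)" using sb sa by simp
    have W: "word_walk a (l # w) = succ a # ?W" by (simp add: l 1 b_def Let_def)
    have "?W \<noteq> [] \<Longrightarrow> hd ?W \<noteq> arev (succ a)"
      using hd w(3) ne neq 1 by (auto simp: sb[symmetric] split: if_splits)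
    then show ?thesis
      unfolding W act using walk nb sa tb 1 l by (simp add: awalk_Cons_iff nonbacktracking_Cons)
  next
    case 2
    have ba: "b \<noteq> a" using turn_by_neq[of i k a] 2 k a by (simp add: b_def)
    then have "succ b \<noteq> succ a" using pred_succ a b by metis
    then have "?W \<noteq> [] \<Longrightarrow> hd ?W \<notin> {a, succ a}"
      using hd hd_w w(3) ne neq ba 2 by (auto split: if_splits)
    moreover have W: "word_walk a (l # w) = ?W" by (simp add: l 2 b_def Let_def)
    moreover have "tail G b = tail G a" using a 2 by (simp add: b_def tail_turn_by_3)
    ultimately show ?thesis unfolding W act using walk nb 2 l by simp
  next
    case 3
    have ba: "b \<noteq> a" using turn_by_neq[of i k a] 3 k a by (simp add: b_def)
    have hb: "head G a = head G b" using a 3 by (simp add: b_def head_turn_by_5)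
    have W: "word_walk a (l # w) = a # arev b # ?W" by (simp add: l 3 b_def Let_def)
    have "?W \<noteq> [] \<Longrightarrow> hd ?W \<noteq> b"
      using hd hd_w w(3) ne neq 3 by (auto split: if_splits)
    then show ?thesis
      unfolding W act using walk nb ba hb a b 3 l
      by (simp add: awalk_Cons_iff nonbacktracking_Cons arev_eq_iff)
  qed
qed

end

context football_tree
begin

text \<open>
  A reduced word fixing a spoke yields a closed walk without backtracking, which is empty in a
  tree. Then all letters are rotations about the white vertex. Being reduced, the word has at most
  one of these, and a nontrivial rotation fixes no spoke.
\<close>

lemma act_free:
  assumes w: "w \<in> words" "fp_reduced integer_mod_group w" and a: "a \<in> spokes"
    and fixed: "act a w = a"
  shows "w = []"
proof -
  have empty: "word_walk a w = []"
    using word_walk_nonbacktracking[OF w a] closed_nonbacktracking_imp_circuit no_circuit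
    unfolding fixed by blast
  show ?thesis
  proof (cases w)
    case (Cons l v)
    obtain i k where l: "l = (i, k)" by (cases l)
    have i: "i = 3" and v: "word_walk (turn_by 3 k a) v = []"
      using empty by (auto simp: Cons l Let_def split: if_splits)
    have "v = []"
    proof (cases v)
      case (Cons l' u)
      with \<open>w = l # v\<close> w(2) have "fst l' \<noteq> 3" by (cases l') (simp add: l i fp_reduced_Cons)
      then show ?thesis using v by (auto simp: Cons Let_def split: if_splits)
    qed
    then have "turn_by 3 k a = a" using fixed by (simp add: Cons l i)
    then show ?thesis using turn_by_neq[of 3 k a] w a by (simp add: Cons l i fp_reduced_Cons)
  qed simp
qed

end

section \<open>Automorphisms and rotations\<close>

context football_graph
begin

text \<open>
  The conditions on an automorphism except for bijectivity. On the tree, bijectivity follows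
  from them, by composing with a homomorphism that moves a spoke back.
\<close>

definition orient_hom :: "('a \<Rightarrow> 'a) \<Rightarrow> ('b \<Rightarrow> 'b) \<Rightarrow> bool" where
  "orient_hom f g \<longleftrightarrow> f \<in> extensional (verts G) \<and> g \<in> extensional (arcs G) \<and>
     (\<forall>a \<in> arcs G. g a \<in> arcs G \<and> tail G (g a) = f (tail G a) \<and> head G (g a) = f (head G a) \<and>
        g (arev a) = arev (g a) \<and> g (succ a) = succ (g a)) \<and>
     (\<forall>v \<in> verts G. col (f v) = col v)"

lemma auts_iff:
  "(f, g) \<in> auts G arev succ col \<longleftrightarrow>
     orient_hom f g \<and> bij_betw f (verts G) (verts G) \<and> bij_betw g (arcs G) (arcs G)"
  by (auto simp: auts_def orient_hom_def Bij_def dest: bij_betwE)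

lemma orient_hom_arc:
  assumes "orient_hom f g" "a \<in> arcs G"
  shows "g a \<in> arcs G" "tail G (g a) = f (tail G a)" "head G (g a) = f (head G a)"
    "g (arev a) = arev (g a)" "g (succ a) = succ (g a)"
  using assms by (simp_all add: orient_hom_def)

lemma orient_hom_vert:
  assumes h: "orient_hom f g" and v: "v \<in> verts G"
  shows "f v \<in> verts G"
proof -
  obtain a where a: "a \<in> arcs G" "tail G a = v" using v by (rule ex_out_arc)
  then have "tail G (g a) = f v" "g a \<in> arcs G" using orient_hom_arc[OF h a(1)] by simp_all
  then show ?thesis using tail_in_verts[of "g a"] by simp
qed

lemma orient_hom_succ_funpow:
  "orient_hom f g \<Longrightarrow> a \<in> arcs G \<Longrightarrow> g ((succ ^^ n) a) = (succ ^^ n) (g a)"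
  by (induction n) (simp_all add: orient_hom_arc)

lemma orient_hom_spoke:
  assumes h: "orient_hom f g" and a: "a \<in> spokes"
  shows "g a \<in> spokes"
proof -
  have "a \<in> arcs G" using a by simp
  then show ?thesis
    using a h orient_hom_arc[OF h, of a]
    by (simp add: spokes_def orient_hom_def del: spoke_arc)
qed

lemma orient_hom_turn:
  assumes h: "orient_hom f g" and a: "a \<in> spokes"
  shows "g (turn i a) = turn i (g a)"
  using a by (simp add: turn_def pred_def orient_hom_succ_funpow[OF h] orient_hom_arc[OF h])

lemma orient_hom_turn_by:
  assumes h: "orient_hom f g" and a: "a \<in> spokes"
  shows "g (turn_by i k a) = turn_by i k (g a)"
proof -
  have "g ((turn i ^^ n) a) = (turn i ^^ n) (g a)" for n
    by (induction n) (simp_all add: orient_hom_turn[OF h] turn_funpow_spoke a)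
  then show ?thesis by (simp add: turn_by_def)
qed

lemma orient_hom_act:
  assumes h: "orient_hom f g"
  shows "w \<in> words \<Longrightarrow> a \<in> spokes \<Longrightarrow> g (act a w) = act (g a) w"
proof (induction w arbitrary: a)
  case (Cons l w)
  then have "turn_by (fst l) (snd l) a \<in> spokes"
    by (simp add: turn_by_def turn_funpow_spoke)
  moreover have "w \<in> words" using Cons.prems by (cases l) simp
  ultimately show ?case using Cons by (simp add: orient_hom_turn_by[OF h])
qed simp

text \<open>
  The arcs on which two homomorphisms agree are closed under rotation and reversal.
\<close>

lemma orient_hom_eqI:
  assumes h: "orient_hom f g" and h': "orient_hom f' g'" and a: "a \<in> arcs G" "g a = g' a"
  shows "f = f' \<and> g = g'"
proof -
  have arcs: "g e = g' e" if "e \<in> arcs G" for e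
    using a(1) that by (induction rule: arcs_induct)
      (simp_all add: a(2) orient_hom_arc[OF h] orient_hom_arc[OF h'])
  have verts: "f v = f' v" if v: "v \<in> verts G" for v
  proof -
    obtain e where e: "e \<in> arcs G" "tail G e = v" using v by (rule ex_out_arc)
    then show ?thesis
      using arcs orient_hom_arc(2)[OF h e(1)] orient_hom_arc(2)[OF h' e(1)] by simp
  qed
  have "g = g'" using h h' arcs by (intro extensionalityI) (auto simp: orient_hom_def)
  moreover have "f = f'" using h h' verts by (intro extensionalityI) (auto simp: orient_hom_def)
  ultimately show ?thesis by simp
qed

lemma orient_hom_id: "orient_hom (restrict id (verts G)) (restrict id (arcs G))"
  by (auto simp: orient_hom_def)

lemma orient_hom_compose:
  assumes h: "orient_hom f g" and h': "orient_hom f' g'"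
  shows "orient_hom (compose (verts G) f f') (compose (arcs G) g g')"
proof -
  have "col (f (f' v)) = col v" if "v \<in> verts G" for v
    using that orient_hom_vert[OF h'] h h' by (simp add: orient_hom_def)
  moreover have "compose (arcs G) g g' (arev a) = arev (compose (arcs G) g g' a)"
    "compose (arcs G) g g' (succ a) = succ (compose (arcs G) g g' a)" if "a \<in> arcs G" for a
    using that by (simp_all add: compose_def orient_hom_arc[OF h] orient_hom_arc[OF h'])
  ultimately show ?thesis
    by (simp add: orient_hom_def compose_extensional)
      (simp add: compose_def orient_hom_arc[OF h] orient_hom_arc[OF h'])
qed

text \<open>
  The image of a seam is prescribed by the spoke preceding it, that of an arc at a black vertex by
  its reverse. Compatibility with \<open>succ\<close> at white and black vertices and with \<open>arev\<close> on seams is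
  compatibility of \<open>\<phi>\<close> with the rotations of order 3, 5 and 2 respectively. A vertex has to go to
  the tail of the image of any arc leaving it, and compatibility with \<open>succ\<close> makes the choice of
  the arc irrelevant.
\<close>

lemma ex_orient_hom_extending:
  assumes spokes: "\<And>a. a \<in> spokes \<Longrightarrow> \<phi> a \<in> spokes"
    and turns: "\<And>i a. i \<in> {2, 3, 5} \<Longrightarrow> a \<in> spokes \<Longrightarrow> \<phi> (turn i a) = turn i (\<phi> a)"
  shows "\<exists>f g. orient_hom f g \<and> (\<forall>a \<in> spokes. g a = \<phi> a)"
proof -
  define g where "g = (\<lambda>e \<in> arcs G. if e \<in> spokes then \<phi> e
    else if e \<in> seams then succ (\<phi> (pred e)) else arev (\<phi> (arev e)))"
  define f where "f = (\<lambda>v \<in> verts G. tail G (g (SOME e. e \<in> arcs G \<and> tail G e = v)))"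
  have g_spoke: "g e = \<phi> e" if "e \<in> spokes" for e
    using that by (simp add: g_def)
  have g_seam: "g e = succ (\<phi> (pred e))" if "e \<in> seams" for e
    using that spoke_not_seam by (auto simp: g_def)
  have g_black: "g e = arev (\<phi> (arev e))" if "arev e \<in> spokes" "e \<in> arcs G" for e
    using that arev_spoke_not_white[of e] by (simp add: g_def)
  have g_arc: "g e \<in> arcs G \<and> col (tail G (g e)) = col (tail G e)" if "e \<in> arcs G" for e
    using that
  proof (cases rule: arcs_cases)
    case 1
    then show ?thesis by (simp add: g_spoke spokes spoke_colours)
  next
    case 2
    then have "succ (\<phi> (pred e)) \<in> seams" using spokes pred_seam succ_spoke by blast
    then show ?thesis using 2 seam_colours seam_arc unfolding g_seam[OF 2] by metis
  next
    case 3
    then have "\<phi> (arev e) \<in> spokes" by (rule spokes)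
    then show ?thesis using 3 that spoke_colours(2)[of "arev e"] by (simp add: g_black spoke_colours)
  qed
  have g_succ: "g (succ e) = succ (g e)" if e: "e \<in> arcs G" for e
    using e
  proof (cases rule: arcs_cases)
    case 1
    then show ?thesis by (simp add: g_spoke g_seam succ_spoke pred_succ)
  next
    case 2
    then have "\<phi> (succ e) = turn 3 (\<phi> (pred e))"
      using turns[of 3 "pred e"] pred_seam by (simp add: turn_def succ_pred)
    then show ?thesis using 2 by (simp add: g_spoke g_seam succ_seam turn_def)
  next
    case 3
    then have "\<phi> (arev (succ e)) = turn 5 (\<phi> (arev e))"
      using turns[of 5 "arev e"] by (simp add: turn_def)
    then show ?thesis using 3 e by (simp add: g_black arev_black turn_def)
  qed
  have g_arev: "g (arev e) = arev (g e)" if e: "e \<in> arcs G" for e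
    using e
  proof (cases rule: arcs_cases)
    case 1
    then show ?thesis by (simp add: g_spoke g_black)
  next
    case 2
    have p: "pred e \<in> spokes" "\<phi> (pred e) \<in> spokes" using 2 pred_seam spokes by blast+
    have "pred (arev e) = turn 2 (pred e)" using 2 by (simp add: turn_def succ_pred)
    then have "\<phi> (pred (arev e)) = turn 2 (\<phi> (pred e))" using turns[of 2 "pred e"] p by simp
    then show ?thesis using 2 p by (simp add: g_seam arev_seam succ_turn2)
  next
    case 3
    then show ?thesis using e by (simp add: g_spoke g_black)
  qed
  have tail: "tail G (g e) = f (tail G e)" if e: "e \<in> arcs G" for e
  proof -
    define e' where "e' = (SOME e'. e' \<in> arcs G \<and> tail G e' = tail G e)"
    have e': "e' \<in> arcs G \<and> tail G e' = tail G e"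
      unfolding e'_def by (rule someI[of _ e]) (simp add: e)
    then have "e' \<in> orbit succ e" using out_arcs_orbit[OF e] by (auto simp: out_arcs_def)
    then have "e' \<in> arcs G \<and> tail G (g e') = tail G (g e)"
      by induction (use e g_succ g_arc in auto)
    then show ?thesis using e by (simp add: f_def e'_def)
  qed
  have "orient_hom f g"
    unfolding orient_hom_def
  proof (intro conjI ballI)
    show "f \<in> extensional (verts G)" "g \<in> extensional (arcs G)" by (simp_all add: f_def g_def)
    fix e assume e: "e \<in> arcs G"
    show "g e \<in> arcs G" "tail G (g e) = f (tail G e)" "g (arev e) = arev (g e)"
      "g (succ e) = succ (g e)"
      using e g_arc tail g_arev g_succ by simp_all
    have "head G (g e) = tail G (g (arev e))" using e g_arc g_arev by simp
    also have "\<dots> = f (head G e)" using e tail[of "arev e"] by simp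
    finally show "head G (g e) = f (head G e)" .
  next
    fix v assume "v \<in> verts G"
    then obtain e where e: "e \<in> arcs G" "tail G e = v" by (rule ex_out_arc)
    then show "col (f v) = col v" using g_arc[of e] tail[of e] by simp
  qed
  with g_spoke show ?thesis by blast
qed

end

context football_tree
begin

lemma act_eq_iff:
  assumes a: "a \<in> spokes" and "u \<in> words" "v \<in> words"
  shows "act a u = act a v \<longleftrightarrow> (u, v) \<in> fp_equiv {2, 3, 5} integer_mod_group"
  using act_free[OF _ _ a] by (rule rotations.free_act_iff) (simp_all add: assms)

text \<open>
  The map sending \<open>act a w\<close> to \<open>act b w\<close> is defined on all spokes by transitivity. It is well
  defined because the action is free: the class of \<open>w\<close> is determined by \<open>act a w\<close>. It commutes
  with the rotations, since these only append a letter to \<open>w\<close>.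
\<close>

lemma ex_orient_hom:
  assumes a: "a \<in> spokes" and b: "b \<in> spokes"
  shows "\<exists>f g. orient_hom f g \<and> g a = b"
proof -
  define wd where "wd x = (SOME w. w \<in> words \<and> act a w = x)" for x
  define \<phi> where "\<phi> x = act b (wd x)" for x
  have wd: "wd x \<in> words \<and> act a (wd x) = x" if "x \<in> spokes" for x
    unfolding wd_def by (rule someI_ex) (use act_transitive[OF a that] in blast)
  have \<phi>: "\<phi> (act a w) = act b w" if w: "w \<in> words" for w
  proof -
    have "act a w \<in> spokes" using w a by (rule rotations.act_closed)
    from wd[OF this] have "(wd (act a w), w) \<in> fp_equiv {2, 3, 5} integer_mod_group"
      using act_eq_iff[OF a _ w, of "wd (act a w)"] by blast
    then show ?thesis unfolding \<phi>_def using b by (rule rotations.act_fp_equiv)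
  qed
  have "\<phi> (turn i x) = turn i (\<phi> x)" if i: "i \<in> {2, 3, 5}" and x: "x \<in> spokes" for i x
  proof -
    have "turn i x = act a (wd x @ [(i, 1)])"
      using wd[OF x] by (simp add: word_act_append)
    also have "\<phi> \<dots> = act b (wd x @ [(i, 1)])" using wd[OF x] i by (intro \<phi>) auto
    finally show ?thesis by (simp add: \<phi>_def word_act_append)
  qed
  moreover have "\<phi> x \<in> spokes" if "x \<in> spokes" for x
    unfolding \<phi>_def using wd[OF that] b by (intro rotations.act_closed) auto
  ultimately obtain f g where "orient_hom f g" "\<forall>x \<in> spokes. g x = \<phi> x"
    using ex_orient_hom_extending by metis
  moreover have "\<phi> a = b" using \<phi>[of "[]"] by simp
  ultimately show ?thesis using a by auto
qed

text \<open>
  Take a homomorphism moving the image of a spoke \<open>a\<close> back to \<open>a\<close>. Both composites fix a spoke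
  and are therefore the identity.
\<close>

lemma orient_hom_imp_aut:
  assumes h: "orient_hom f g"
  shows "(f, g) \<in> auts G arev succ col"
proof -
  obtain a where a: "a \<in> spokes" using spokes_nonempty by blast
  have b: "g a \<in> spokes" using orient_hom_spoke[OF h a] .
  obtain f' g' where h': "orient_hom f' g'" "g' (g a) = a" using ex_orient_hom[OF b a] by blast
  have inv: "(\<forall>v \<in> verts G. f2 (f1 v) = v) \<and> (\<forall>e \<in> arcs G. g2 (g1 e) = e)"
    if "orient_hom f1 g1" "orient_hom f2 g2" "c \<in> spokes" "g2 (g1 c) = c" for f1 g1 f2 g2 c
  proof -
    have "compose (verts G) f2 f1 = restrict id (verts G) \<and>
        compose (arcs G) g2 g1 = restrict id (arcs G)"
      using orient_hom_compose[OF that(2,1)] orient_hom_id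
      by (rule orient_hom_eqI[where a = c]) (simp_all add: that compose_eq)
    then have "compose (verts G) f2 f1 v = restrict id (verts G) v"
      "compose (arcs G) g2 g1 e = restrict id (arcs G) e" for v e
      by simp_all
    then show ?thesis by (metis compose_eq restrict_apply id_apply)
  qed
  have "g (g' (g a)) = g a" using h'(2) by simp
  with inv[OF h h'(1) a] inv[OF h'(1) h b] h'(2)
  have v: "\<forall>v \<in> verts G. f' (f v) = v" "\<forall>v \<in> verts G. f (f' v) = v"
    and e: "\<forall>e \<in> arcs G. g' (g e) = e" "\<forall>e \<in> arcs G. g (g' e) = e" by blast+
  have "bij_betw f (verts G) (verts G)"
    using v orient_hom_vert[OF h] orient_hom_vert[OF h'(1)]
    by (intro bij_betw_byWitness[where f' = f']) auto
  moreover have "bij_betw g (arcs G) (arcs G)"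
    using e orient_hom_arc(1)[OF h] orient_hom_arc(1)[OF h'(1)]
    by (intro bij_betw_byWitness[where f' = g']) auto
  ultimately show ?thesis using h by (simp add: auts_iff)
qed

lemma auts_eq: "(f, g) \<in> auts G arev succ col \<longleftrightarrow> orient_hom f g"
  using orient_hom_imp_aut auts_iff by blast

lemma carrier_Aut: "carrier (Aut G arev succ col) = auts G arev succ col"
  by (simp add: Aut_def)

lemma mult_Aut:
  assumes "(f, g) \<in> auts G arev succ col" "(f', g') \<in> auts G arev succ col"
  shows "(f, g) \<otimes>\<^bsub>Aut G arev succ col\<^esub> (f', g') =
    (compose (verts G) f f', compose (arcs G) g g')"
  using assms by (simp add: Aut_def BijGroup_def DirProd_def auts_def)

text \<open>
  Automorphisms act simply transitively on the spokes and commute with the rotations, which act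
  simply transitively as well. Evaluation at a base spoke therefore identifies the group with the
  free product.
\<close>

theorem Aut_iso_free_product:
  "Aut G arev succ col \<cong> free_product {2, 3, 5 :: nat} integer_mod_group"
proof -
  obtain a where a: "a \<in> spokes" using spokes_nonempty by blast
  show ?thesis
  proof (rule rotations.iso_free_product[where x = a and ev = "\<lambda>p. snd p a"])
    show "a \<in> spokes" by (rule a)
    show "w = []" if "w \<in> words" "fp_reduced integer_mod_group w" "act a w = a" for w
      using act_free[OF that(1,2) a that(3)] .
    show "\<exists>w \<in> words. act a w = y" if "y \<in> spokes" for y
      using act_transitive[OF a that] .
    show "bij_betw (\<lambda>p. snd p a) (carrier (Aut G arev succ col)) spokes"
      unfolding carrier_Aut bij_betw_def
    proof
      show "inj_on (\<lambda>p. snd p a) (auts G arev succ col)"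
      proof (rule inj_onI)
        fix p q
        assume pq: "p \<in> auts G arev succ col" "q \<in> auts G arev succ col" "snd p a = snd q a"
        then have "orient_hom (fst p) (snd p)" "orient_hom (fst q) (snd q)"
          by (simp_all add: auts_eq[symmetric])
        then have "fst p = fst q \<and> snd p = snd q" using pq(3) a by (intro orient_hom_eqI) auto
        then show "p = q" by (simp add: prod_eq_iff)
      qed
      show "(\<lambda>p. snd p a) ` auts G arev succ col = spokes"
      proof
        show "(\<lambda>p. snd p a) ` auts G arev succ col \<subseteq> spokes"
          using orient_hom_spoke a by (auto simp: auts_eq)
        show "spokes \<subseteq> (\<lambda>p. snd p a) ` auts G arev succ col"
        proof
          fix b assume "b \<in> spokes"
          then obtain f g where "orient_hom f g" "g a = b" using ex_orient_hom[OF a] by blast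
          then show "b \<in> (\<lambda>p. snd p a) ` auts G arev succ col"
            by (intro image_eqI[of _ _ "(f, g)"]) (simp_all add: auts_eq)
        qed
      qed
    qed
    fix p q
    assume pq: "p \<in> carrier (Aut G arev succ col)" "q \<in> carrier (Aut G arev succ col)"
    obtain f g f' g' where p: "p = (f, g)" and q: "q = (f', g')" by (cases p, cases q)
    have h: "orient_hom f g" "orient_hom f' g'" using pq by (auto simp: p q carrier_Aut auts_eq)
    have pq_eq: "p \<otimes>\<^bsub>Aut G arev succ col\<^esub> q = (compose (verts G) f f', compose (arcs G) g g')"
      using pq unfolding p q carrier_Aut by (rule mult_Aut)
    show "p \<otimes>\<^bsub>Aut G arev succ col\<^esub> q \<in> carrier (Aut G arev succ col)"
      unfolding pq_eq carrier_Aut auts_eq using h by (rule orient_hom_compose)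
    fix w assume w: "w \<in> words" and q_a: "snd q a = act a w"
    show "snd (p \<otimes>\<^bsub>Aut G arev succ col\<^esub> q) a = act (snd p a) w"
      using q_a a orient_hom_act[OF h(1) w a] by (simp add: pq_eq) (simp add: p q compose_eq)
  qed
qed

end

theorem theorem1:
  fixes T :: "('a, 'b) pre_digraph" and arev succ :: "'b \<Rightarrow> 'b" and col :: "'a \<Rightarrow> colour"
  assumes "football_tree T arev succ col"
  shows "Aut T arev succ col \<cong> free_product {2, 3, 5 :: nat} integer_mod_group"
proof -
  interpret football_tree T arev succ col by (rule assms)
  show ?thesis by (rule Aut_iso_free_product)
qed

end
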